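(* In exact arithmetic, a sweep that visits the complete set $\mathcal B$, constructs the same transformed fixed-$\theta$ data as independent recomputation, and applies the guarded hull-reuse rule produces fixed-threshold LP bounds and exact-search certificates with the same validity status as independent enumeration.
   Context: Data. There are items $i=1,\dots,n$. Item $i$ has a finite price menu $\mathcal X_i=\{x_{i,1},\dots,x_{i,m}\}\subset\mathbb R$, a reference price $a_i>0$, an exposure $\omega_i>0$, a nominal demand function $\hat g_i:\mathcal X_i\to\mathbb R_{>0}$ (monotone decreasing on the admissible range), and a relative tolerance $\sigma_i$. A margin target $\Delta>0$ and an integer budget $\Gamma\in\{0,1,\dots,n\}$ are given. The admissible menu $\mathcal X_i^{\mathrm{ad}}=\mathcal X_i\cap[(1-\sigma_i)a_i,(1+\sigma_i)a_i]$ is assumed nonempty. A variability parameter $\delta_i(x_i)$ is given with $0\le\delta_i(x_i)<\hat g_i(x_i)$ on $\mathcal X_i^{\mathrm{ad}}$. All option indices $j$ range over admissible ("original") options of item $i$. Fixed-$\theta$ data. Put $v_{ij}=\omega_i x_{i,j}\hat g_i(x_{i,j})$, $s_{ij}=\omega_i(x_{i,j}-\Delta a_i)\hat g_i(x_{i,j})$, $t_{ij}=\omega_i(x_{i,j}-\Delta a_i)\delta_i(x_{i,j})$, and $\mathcal B=\{0\}\cup\{|t_{ij}|: x_{i,j}\in\mathcal X_i^{\mathrm{ad}}\}$. For $\theta\in\mathcal B$ let $s^\theta_{ij}=s_{ij}-\max\{0,|t_{ij}|-\theta\}$ (so $s^\theta_{ij}=s_{ij}$ if $\theta\ge|t_{ij}|$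 and $s^\theta_{ij}=s_{ij}-|t_{ij}|+\theta$ if $\theta<|t_{ij}|$), choose $j^\theta(i)\in\arg\max_j s^\theta_{ij}$, and set $c^\theta_{ij}=s^\theta_{i,j^\theta(i)}-s^\theta_{ij}$, $C^\theta=\sum_i s^\theta_{i,j^\theta(i)}-\Gamma\theta$. The fixed-$\theta$ MCKP is: choose one option $j(i)$ per item to maximize $\sum_i v_{i,j(i)}$ subject to $\sum_i c^\theta_{i,j(i)}\le C^\theta$; its optimal value is $Z^{\mathrm{IP}}(\theta)$ ($-\infty$ if infeasible). The item hull of $i$ at $\theta$ is the vertex sequence, in increasing cost, of the efficient concave upper frontier of the point set $\{(c^\theta_{ij},v_{ij})\}_j$ (after removing cost–value dominated points). The fixed-threshold LP bound is the optimum of the LP relaxation, computed by starting each item at its first hull vertex and filling hull segments greedily in nonincreasing order of slope up to capacity $C^\theta$. Procedures. Independent enumeration computes, for every $\theta\in\mathcal B$, all the fixed-$\theta$ data and all item hulls from scratch. The sweep visits the thresholds of $\mathcal B$ in sorted order, tracking $s^\theta_{ij}$ through the piecewise-affine identity above. Guarded hull-reuse rule: the hull of an item is carried over from the previous threshold only when that item's complete transformed cost–value point multiset $\{(c^\theta_{ij},v_{ij})\}_j$ is unchanged; otherwise the hull is rebuilt from the original admissible options. In both procedures, exact search at a fixed $\theta$ is branch-and-bound that branches over all original options except those removed by the integer-safe dominance rule (an option may be removed only if another option of the same item has weakly smaller $c^\theta$ and weakly larger $v$, at least one strictly), uses hulls only to compute residual LP upper bounds, and prunes a node only if it is infeasible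 or its residual LP bound is at most the incumbent value. Validity status. A fixed-threshold LP bound is valid if it is at least $Z^{\mathrm{IP}}(\theta)$. An exact-search certificate is valid if what it asserts is true: for a completed fixed-$\theta$ search, that the returned incumbent is optimal for the fixed-$\theta$ MCKP; for the global search over all of $\mathcal B$, that the best incumbent satisfying the robust margin constraint ($\sum_i s_{i,j(i)}$ minus the sum of the $\Gamma$ largest $|t_{i,j(i)}|$ is $\ge0$) is globally optimal among such selections, or, under limits with a valid upper bound $U_\theta\ge Z^{\mathrm{IP}}(\theta)$ recorded for every $\theta\in\mathcal B$, that the robust optimum lies between the incumbent value and $\max_{\theta\in\mathcal B}U_\theta$. "Same validity status" means that the sweep's bound or certificate is valid exactly when that of independent enumeration is. *)

theory Defs
  imports "HOL-Analysis.Analysis" "HOL-Library.Multiset"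
begin

section \<open>Instances\<close>

text \<open>Items are \<open>1, \<dots>, n\<close> and the menu of item \<open>i\<close> is \<open>{x i 1, \<dots>, x i m}\<close>.\<close>

record pricing =
  num_items :: nat
  menu_size :: nat
  price :: "nat \<Rightarrow> nat \<Rightarrow> real"
  ref_price :: "nat \<Rightarrow> real"
  exposure :: "nat \<Rightarrow> real"
  demand :: "nat \<Rightarrow> real \<Rightarrow> real"
  tolerance :: "nat \<Rightarrow> real"
  margin :: real
  budget :: nat
  variability :: "nat \<Rightarrow> real \<Rightarrow> real"

definition items :: "pricing \<Rightarrow> nat set" where
  "items P = {1..num_items P}"

definition admissible :: "pricing \<Rightarrow> nat \<Rightarrow> nat set" where
  "admissible P i = {j \<in> {1..menu_size P}.
     price P i j \<in> {(1 - tolerance P i) * ref_price P i .. (1 + tolerance P i) * ref_price P i}}"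

definition valid_instance :: "pricing \<Rightarrow> bool" where
  "valid_instance P \<longleftrightarrow>
     0 < margin P \<and> budget P \<le> num_items P \<and>
     (\<forall>i\<in>items P.
        0 < ref_price P i \<and> 0 < exposure P i \<and>
        (\<forall>j\<in>{1..menu_size P}. 0 < demand P i (price P i j)) \<and>
        antimono_on (price P i ` admissible P i) (demand P i) \<and>
        admissible P i \<noteq> {} \<and>
        (\<forall>j\<in>admissible P i. 0 \<le> variability P i (price P i j) \<and>
                             variability P i (price P i j) < demand P i (price P i j)))"

definition v_coeff :: "pricing \<Rightarrow> nat \<Rightarrow> nat \<Rightarrow> real" where
  "v_coeff P i j = exposure P i * price P i j * demand P i (price P i j)"

definition s_coeff :: "pricing \<Rightarrow> nat \<Rightarrow> nat \<Rightarrow> real" where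
  "s_coeff P i j = exposure P i * (price P i j - margin P * ref_price P i) * demand P i (price P i j)"

definition t_coeff :: "pricing \<Rightarrow> nat \<Rightarrow> nat \<Rightarrow> real" where
  "t_coeff P i j = exposure P i * (price P i j - margin P * ref_price P i) * variability P i (price P i j)"

definition thresholds :: "pricing \<Rightarrow> real set" where
  "thresholds P = {0} \<union> {\<bar>t_coeff P i j\<bar> | i j. i \<in> items P \<and> j \<in> admissible P i}"

definition selections :: "pricing \<Rightarrow> (nat \<Rightarrow> nat) set" where
  "selections P = (\<Pi>\<^sub>E i\<in>items P. admissible P i)"

definition revenue :: "pricing \<Rightarrow> (nat \<Rightarrow> nat) \<Rightarrow> real" where
  "revenue P f = (\<Sum>i\<in>items P. v_coeff P i (f i))"

definition robust_feasible :: "pricing \<Rightarrow> (nat \<Rightarrow> nat) set" where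
  "robust_feasible P = {f \<in> selections P.
     0 \<le> (\<Sum>i\<in>items P. s_coeff P i (f i))
         - sum_list (take (budget P)
             (rev (sort (map (\<lambda>i. \<bar>t_coeff P i (f i)\<bar>) [1..<Suc (num_items P)]))))}"

text \<open>Optimal values live in the extended reals, so that an empty supremum is \<open>-\<infinity>\<close>.\<close>

definition robust_optimum :: "pricing \<Rightarrow> ereal" where
  "robust_optimum P = (SUP f\<in>robust_feasible P. ereal (revenue P f))"


section \<open>Fixed-threshold data and the multiple-choice knapsack problem\<close>

record fixed_data =
  shifted :: "nat \<Rightarrow> nat \<Rightarrow> real"
  cost :: "nat \<Rightarrow> nat \<Rightarrow> real"
  gain :: "nat \<Rightarrow> nat \<Rightarrow> real"
  capacity :: real

definition s_shift :: "pricing \<Rightarrow> real \<Rightarrow> nat \<Rightarrow> nat \<Rightarrow> real" where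
  "s_shift P \<theta> i j = s_coeff P i j - max 0 (\<bar>t_coeff P i j\<bar> - \<theta>)"

definition best_option :: "pricing \<Rightarrow> real \<Rightarrow> nat \<Rightarrow> nat" where
  "best_option P \<theta> i = arg_max_on (s_shift P \<theta> i) (admissible P i)"

definition recompute :: "pricing \<Rightarrow> real \<Rightarrow> fixed_data" where
  "recompute P \<theta> =
     \<lparr> shifted = s_shift P \<theta>,
       cost = (\<lambda>i j. s_shift P \<theta> i (best_option P \<theta> i) - s_shift P \<theta> i j),
       gain = v_coeff P,
       capacity = (\<Sum>i\<in>items P. s_shift P \<theta> i (best_option P \<theta> i)) - real (budget P) * \<theta> \<rparr>"

definition total_gain :: "pricing \<Rightarrow> fixed_data \<Rightarrow> (nat \<Rightarrow> nat) \<Rightarrow> real" where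
  "total_gain P D f = (\<Sum>i\<in>items P. gain D i (f i))"

definition mckp_feasible :: "pricing \<Rightarrow> fixed_data \<Rightarrow> (nat \<Rightarrow> nat) set" where
  "mckp_feasible P D = {f \<in> selections P. (\<Sum>i\<in>items P. cost D i (f i)) \<le> capacity D}"

definition Z_IP :: "pricing \<Rightarrow> real \<Rightarrow> ereal" where
  "Z_IP P \<theta> = (SUP f\<in>mckp_feasible P (recompute P \<theta>). ereal (total_gain P (recompute P \<theta>) f))"


section \<open>Item hulls and LP bounds\<close>

text \<open>Points are pairs (cost, value).\<close>

definition efficient_points :: "(real \<times> real) set \<Rightarrow> (real \<times> real) set" where
  "efficient_points A =
     {p \<in> A. \<not> (\<exists>q\<in>A. fst q \<le> fst p \<and> snd p \<le> snd q \<and> (fst q < fst p \<or> snd p < snd q))}"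

definition hull_vertices :: "(real \<times> real) set \<Rightarrow> (real \<times> real) set" where
  "hull_vertices A =
     {p. p extreme_point_of (convex hull (efficient_points A)) \<and>
         (\<forall>q \<in> convex hull (efficient_points A). fst q = fst p \<longrightarrow> snd q \<le> snd p)}"

text \<open>Distinct efficient points have distinct costs, so for finite \<open>A\<close> exactly one such list exists.\<close>

definition concave_frontier :: "(real \<times> real) set \<Rightarrow> (real \<times> real) list" where
  "concave_frontier A = (THE h. sorted_wrt (\<lambda>p q. fst p < fst q) h \<and> set h = hull_vertices A)"

lemma concave_frontier_spec:
  assumes "finite A"
  shows "sorted_wrt (\<lambda>p q. fst p < fst q) (concave_frontier A) \<and> set (concave_frontier A) = hull_vertices A"
proof -
  have sub: "hull_vertices A \<subseteq> efficient_points A"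
    unfolding hull_vertices_def using extreme_point_of_convex_hull by auto
  have inj: "inj_on fst (efficient_points A)"
    unfolding inj_on_def efficient_points_def by (force simp: prod_eq_iff)
  have fin: "finite (hull_vertices A)" using sub assms unfolding efficient_points_def
    by (auto intro: finite_subset)
  have injh: "inj_on fst (hull_vertices A)" using inj sub inj_on_subset by blast
  obtain xs where xs: "set xs = hull_vertices A" "distinct xs" using finite_distinct_list[OF fin] by auto
  let ?h = "sort_key fst xs"
  have "distinct (map fst ?h)" using injh xs by (simp add: distinct_map)
  hence "sorted_wrt (<) (map fst ?h)" by (simp add: strict_sorted_iff del: distinct_map)
  hence 1: "sorted_wrt (\<lambda>p q. fst p < fst q) ?h \<and> set ?h = hull_vertices A" using xs by (simp add: sorted_wrt_map)
  show ?thesis unfolding concave_frontier_def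
  proof (rule theI[where a="sort_key fst xs"], rule 1)
    fix h assume h: "sorted_wrt (\<lambda>p q. fst p < fst q) h \<and> set h = hull_vertices A"
    have "map fst h = map fst ?h"
      by (rule strict_sorted_equal) (use h 1 in \<open>auto simp: sorted_wrt_map\<close>)
    thus "h = ?h" using h 1 injh inj_on_map_eq_map[of fst h ?h] by simp
  qed
qed

definition point_mset :: "pricing \<Rightarrow> fixed_data \<Rightarrow> nat \<Rightarrow> (real \<times> real) multiset" where
  "point_mset P D i = image_mset (\<lambda>j. (cost D i j, gain D i j)) (mset_set (admissible P i))"

definition build_hull :: "pricing \<Rightarrow> fixed_data \<Rightarrow> nat \<Rightarrow> (real \<times> real) list" where
  "build_hull P D i = concave_frontier ((\<lambda>j. (cost D i j, gain D i j)) ` admissible P i)"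

definition hull_segments :: "(real \<times> real) list \<Rightarrow> (real \<times> real) list" where
  "hull_segments h = map (\<lambda>(p, q). q - p) (zip h (tl h))"

fun greedy_fill :: "real \<Rightarrow> (real \<times> real) list \<Rightarrow> real" where
  "greedy_fill K [] = 0"
| "greedy_fill K ((dc, dv) # S) =
     (if dc \<le> K then dv + greedy_fill (K - dc) S else dv * (K / dc))"

text \<open>A search node is a partial selection. Its residual LP keeps the options already fixed and
  relaxes the remaining items through their hulls; the bound is \<open>-\<infinity>\<close> when even the first hull
  vertices exceed the capacity that is left.\<close>

definition residual_bound ::
  "pricing \<Rightarrow> fixed_data \<Rightarrow> (nat \<Rightarrow> (real \<times> real) list) \<Rightarrow> (nat \<Rightarrow> nat option) \<Rightarrow> ereal" where
  "residual_bound P D H p =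
     (let fixed = items P \<inter> dom p;
          free = items P - dom p;
          K = capacity D - (\<Sum>i\<in>fixed. cost D i (the (p i))) - (\<Sum>i\<in>free. fst (hd (H i)));
          base = (\<Sum>i\<in>fixed. gain D i (the (p i))) + (\<Sum>i\<in>free. snd (hd (H i)));
          segs = concat (map (\<lambda>i. hull_segments (H i)) (sorted_list_of_set free))
      in if K < 0 then -\<infinity>
         else ereal (base + greedy_fill K (sort_key (\<lambda>(dc, dv). - (dv / dc)) segs)))"


section \<open>Branch-and-bound\<close>

definition incumbent_value :: "pricing \<Rightarrow> fixed_data \<Rightarrow> (nat \<Rightarrow> nat) option \<Rightarrow> ereal" where
  "incumbent_value P D inc = (case inc of None \<Rightarrow> -\<infinity> | Some f \<Rightarrow> ereal (total_gain P D f))"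

definition extends :: "(nat \<Rightarrow> nat) \<Rightarrow> (nat \<Rightarrow> nat option) \<Rightarrow> bool" where
  "extends f p \<longleftrightarrow> (\<forall>i\<in>dom p. p i = Some (f i))"

definition dominated_option :: "pricing \<Rightarrow> fixed_data \<Rightarrow> nat \<Rightarrow> nat \<Rightarrow> bool" where
  "dominated_option P D i j \<longleftrightarrow>
     (\<exists>j'\<in>admissible P i. cost D i j' \<le> cost D i j \<and> gain D i j \<le> gain D i j' \<and>
        (cost D i j' < cost D i j \<or> gain D i j < gain D i j'))"

text \<open>The pairs (open nodes, incumbent) that a search can reach. Node order, branching item, the
  use made of the dominance rule and the moment at which feasible completions are found (at a leaf
  or earlier) are left unspecified, so every concrete strategy is covered.\<close>

inductive search_state ::
  "pricing \<Rightarrow> fixed_data \<Rightarrow> (nat \<Rightarrow> (real \<times> real) list)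
    \<Rightarrow> (nat \<Rightarrow> nat option) set \<Rightarrow> (nat \<Rightarrow> nat) option \<Rightarrow> bool"
  for P D H where
  start: "search_state P D H {Map.empty} None"
| improve: "search_state P D H N (Some f)"
  if "search_state P D H N inc" "p \<in> N" "f \<in> mckp_feasible P D" "extends f p"
     "incumbent_value P D inc < ereal (total_gain P D f)"
| prune: "search_state P D H (N - {p}) inc"
  if "search_state P D H N inc" "p \<in> N"
     "\<not> (\<exists>f\<in>mckp_feasible P D. extends f p) \<or> residual_bound P D H p \<le> incumbent_value P D inc"
| branch: "search_state P D H (N - {p} \<union> (\<lambda>j. p(i \<mapsto> j)) ` J) inc"
  if "search_state P D H N inc" "p \<in> N" "i \<in> items P" "p i = None"
     "J \<subseteq> admissible P i" "\<forall>j\<in>admissible P i - J. dominated_option P D i j"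


section \<open>The two procedures\<close>

text \<open>What a procedure holds at each threshold; everything it outputs is derived from this.\<close>

record enumeration =
  data_at :: "real \<Rightarrow> fixed_data"
  hull_at :: "real \<Rightarrow> nat \<Rightarrow> (real \<times> real) list"

definition independent_enumeration :: "pricing \<Rightarrow> enumeration" where
  "independent_enumeration P =
     \<lparr> data_at = recompute P, hull_at = (\<lambda>\<theta>. build_hull P (recompute P \<theta>)) \<rparr>"

definition sweep_order :: "pricing \<Rightarrow> real list \<Rightarrow> enumeration \<Rightarrow> bool" where
  "sweep_order P \<Theta> E \<longleftrightarrow>
     sorted_wrt (<) \<Theta> \<and>
     (\<forall>\<theta>\<in>set \<Theta>. \<forall>i\<in>items P. \<forall>j\<in>admissible P i.
        shifted (data_at E \<theta>) i j =
          (if \<bar>t_coeff P i j\<bar> \<le> \<theta> then s_coeff P i j else s_coeff P i j - \<bar>t_coeff P i j\<bar> + \<theta>))"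

text \<open>Data at inadmissible indices are irrelevant and not compared.\<close>

definition same_fixed_data :: "pricing \<Rightarrow> fixed_data \<Rightarrow> fixed_data \<Rightarrow> bool" where
  "same_fixed_data P D D' \<longleftrightarrow>
     capacity D = capacity D' \<and>
     (\<forall>i\<in>items P. \<forall>j\<in>admissible P i.
        shifted D i j = shifted D' i j \<and> cost D i j = cost D' i j \<and> gain D i j = gain D' i j)"

definition guarded_hull_reuse :: "pricing \<Rightarrow> real list \<Rightarrow> enumeration \<Rightarrow> bool" where
  "guarded_hull_reuse P \<Theta> E \<longleftrightarrow>
     (\<forall>k<length \<Theta>. \<forall>i\<in>items P.
        (0 < k \<and>
         point_mset P (data_at E (\<Theta> ! k)) i = point_mset P (data_at E (\<Theta> ! (k - 1))) i \<and>
         hull_at E (\<Theta> ! k) i = hull_at E (\<Theta> ! (k - 1)) i) \<or>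
        hull_at E (\<Theta> ! k) i = build_hull P (data_at E (\<Theta> ! k)) i)"


section \<open>Outputs and their validity\<close>

definition lp_bound :: "pricing \<Rightarrow> enumeration \<Rightarrow> real \<Rightarrow> ereal" where
  "lp_bound P E \<theta> = residual_bound P (data_at E \<theta>) (hull_at E \<theta>) Map.empty"

definition lp_bound_valid :: "pricing \<Rightarrow> real \<Rightarrow> ereal \<Rightarrow> bool" where
  "lp_bound_valid P \<theta> b \<longleftrightarrow> Z_IP P \<theta> \<le> b"

definition completed_search :: "pricing \<Rightarrow> enumeration \<Rightarrow> real \<Rightarrow> (nat \<Rightarrow> nat) option \<Rightarrow> bool" where
  "completed_search P E \<theta> inc \<longleftrightarrow> search_state P (data_at E \<theta>) (hull_at E \<theta>) {} inc"

text \<open>Returning no incumbent asserts infeasibility.\<close>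

definition fixed_certificate_valid :: "pricing \<Rightarrow> real \<Rightarrow> (nat \<Rightarrow> nat) option \<Rightarrow> bool" where
  "fixed_certificate_valid P \<theta> inc \<longleftrightarrow>
     (case inc of
        None \<Rightarrow> mckp_feasible P (recompute P \<theta>) = {}
      | Some f \<Rightarrow> f \<in> mckp_feasible P (recompute P \<theta>) \<and>
                  ereal (total_gain P (recompute P \<theta>) f) = Z_IP P \<theta>)"

definition best_robust_incumbent ::
  "pricing \<Rightarrow> (real \<Rightarrow> (nat \<Rightarrow> nat) option) \<Rightarrow> (nat \<Rightarrow> nat) option \<Rightarrow> bool" where
  "best_robust_incumbent P inc r \<longleftrightarrow>
     (let R = {f \<in> robust_feasible P. \<exists>\<theta>\<in>thresholds P. inc \<theta> = Some f}
      in case r of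
           None \<Rightarrow> R = {}
         | Some f \<Rightarrow> f \<in> R \<and> (\<forall>g\<in>R. revenue P g \<le> revenue P f))"

definition completed_global_search :: "pricing \<Rightarrow> enumeration \<Rightarrow> (nat \<Rightarrow> nat) option \<Rightarrow> bool" where
  "completed_global_search P E r \<longleftrightarrow>
     (\<exists>inc. (\<forall>\<theta>\<in>thresholds P. completed_search P E \<theta> (inc \<theta>)) \<and> best_robust_incumbent P inc r)"

definition global_certificate_valid :: "pricing \<Rightarrow> (nat \<Rightarrow> nat) option \<Rightarrow> bool" where
  "global_certificate_valid P r \<longleftrightarrow>
     (case r of
        None \<Rightarrow> robust_feasible P = {}
      | Some f \<Rightarrow> f \<in> robust_feasible P \<and> (\<forall>g\<in>robust_feasible P. revenue P g \<le> revenue P f))"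

text \<open>Under limits the search at each threshold may stop in any state, the initial one included.\<close>

definition limited_global_search ::
  "pricing \<Rightarrow> enumeration \<Rightarrow> (nat \<Rightarrow> nat) option \<Rightarrow> (real \<Rightarrow> ereal) \<Rightarrow> bool" where
  "limited_global_search P E r U \<longleftrightarrow>
     (\<exists>inc. (\<forall>\<theta>\<in>thresholds P. \<exists>N. search_state P (data_at E \<theta>) (hull_at E \<theta>) N (inc \<theta>)) \<and>
            best_robust_incumbent P inc r) \<and>
     (\<forall>\<theta>\<in>thresholds P. Z_IP P \<theta> \<le> U \<theta>)"

definition limited_certificate_valid ::
  "pricing \<Rightarrow> (nat \<Rightarrow> nat) option \<Rightarrow> (real \<Rightarrow> ereal) \<Rightarrow> bool" where
  "limited_certificate_valid P r U \<longleftrightarrow>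
     (case r of None \<Rightarrow> -\<infinity> | Some f \<Rightarrow> ereal (revenue P f)) \<le> robust_optimum P \<and>
     robust_optimum P \<le> Max (U ` thresholds P)"

end

theory Submission
  imports Defs
begin

text \<open>
  Both procedures are correct, so every bound and certificate that either of them produces is valid,
  and the validity statuses agree because both sides are true. Two facts make the sweep correct. A
  hull is a function of the point multiset, so a carried-over hull is the hull that a rebuild
  would give (\<open>guarded_reuse_builds_hull\<close>); and the sweep's data agree with recomputed data
  wherever selections look. What remains is the correctness of branch-and-bound on hulls built from
  the data at hand, and the reduction of the robust problem to the fixed-threshold ones.

  The residual LP bound is an upper bound by weak duality. The multiplier \<open>l\<close> of the capacity
  constraint is the slope of the segment at which the greedy filling breaks off, or zero if all
  segments fit, and for this \<open>l\<close> the greedy value dominates the dual objective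
  (\<open>greedy_fill_dual\<close>). For a single item, the maximum of \<open>gain - l * cost\<close>
  over all options is attained at a hull vertex, and walking along the hull from its first vertex to
  that vertex collects segment terms \<open>dv - l * dc\<close>, which are at most their positive parts.
  Adding up over the free items bounds every feasible completion (\<open>residual_bound_upper\<close>).

  Branch-and-bound then keeps the invariant that each feasible selection is matched by the incumbent
  or by a feasible selection in an open node, where an option lost to dominance is exchanged for an
  undominated one (\<open>search_state_covers\<close>). With no open node left, the incumbent is optimal.

  The sum of the \<open>k\<close> largest among at least \<open>k\<close> nonnegative numbers \<open>x\<close> is the minimum over \<open>\<theta> \<ge> 0\<close> of
  \<open>k * \<theta> + (\<Sum>x. max 0 (x - \<theta>))\<close>, attained at zero or at one of the numbers. Hence a selection
  is robustly feasible iff it is feasible at some threshold (\<open>robust_feasible_eq\<close>), and the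
  robust optimum is the best of the fixed-threshold optima. This makes the best incumbent of the
  completed searches a robust optimum, and the largest of valid upper bounds recorded under limits
  an upper bound on it.
\<close>

section \<open>Points, efficient points and hull vertices\<close>

lemma efficient_point_above:
  assumes "finite A" "p \<in> A"
  shows "\<exists>q\<in>efficient_points A. fst q \<le> fst p \<and> snd p \<le> snd q"
proof -
  let ?B = "{q\<in>A. fst q \<le> fst p \<and> snd p \<le> snd q}"
  have "finite ?B" "p \<in> ?B"
    using assms by auto
  \<comment> \<open>A point that dominated a maximizer of value minus cost would have a larger difference.\<close>
  then have "Max ((\<lambda>q. snd q - fst q) ` ?B) \<in> (\<lambda>q. snd q - fst q) ` ?B"
    by (intro Max_in) blast+
  then obtain q where q: "q \<in> ?B" "Max ((\<lambda>q. snd q - fst q) ` ?B) = snd q - fst q"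
    by (rule imageE)
  have q_max: "snd r - fst r \<le> snd q - fst q" if "r \<in> ?B" for r
    unfolding q(2)[symmetric] using \<open>finite ?B\<close> that by (intro Max_ge) blast+
  have "q \<in> efficient_points A"
    unfolding efficient_points_def
  proof (intro CollectI conjI notI)
    show "q \<in> A" using q by simp
    assume "\<exists>r\<in>A. fst r \<le> fst q \<and> snd q \<le> snd r \<and> (fst r < fst q \<or> snd q < snd r)"
    then obtain r where "r \<in> A" "fst r \<le> fst q" "snd q \<le> snd r" "fst r < fst q \<or> snd q < snd r"
      by blast
    with q(1) q_max[of r] show False by auto
  qed
  with q(1) show ?thesis by auto
qed

text \<open>
  The maximizers of the functional over the hull form a face, and its points of largest value form a
  face again. Extreme points of a face are extreme points of the whole set, and passing to the
  second face places the point on the upper boundary even when the functional ignores the value,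
  as it does when costs are minimized. By the signs of \<open>a\<close> and \<open>b\<close>, replacing
  a point by an efficient one above it does not decrease the functional.
\<close>

lemma hull_vertex_maximizing:
  fixes a b :: real
  assumes fin: "finite A" and p: "p \<in> A" and a: "a \<le> 0" and b: "0 \<le> b"
  shows "\<exists>h\<in>hull_vertices A. a * fst p + b * snd p \<le> a * fst h + b * snd h"
proof -
  define C where "C = convex hull (efficient_points A)"
  obtain q where q: "q \<in> efficient_points A" "fst q \<le> fst p" "snd p \<le> snd q"
    using efficient_point_above[OF fin p] by blast
  have qC: "q \<in> C"
    using q(1) by (simp add: C_def hull_inc)
  have "finite (efficient_points A)"
    using fin by (simp add: efficient_points_def)
  then have C: "compact C" "convex C"
    by (simp_all add: C_def finite_imp_compact_convex_hull)
  have attains: "\<exists>m\<in>S. \<forall>x\<in>S. d \<bullet> x \<le> d \<bullet> m" if "compact S" "S \<noteq> {}"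
    for S and d :: "real \<times> real"
    using that by (intro continuous_attains_sup continuous_intros)
  obtain m where m: "m \<in> C" "\<And>x. x \<in> C \<Longrightarrow> (a, b) \<bullet> x \<le> (a, b) \<bullet> m"
    using attains[OF C(1), of "(a, b)"] qC by blast
  define F where "F = C \<inter> {x. (a, b) \<bullet> x = (a, b) \<bullet> m}"
  have F: "F face_of C"
    unfolding F_def using C(2) m(2) by (intro face_of_Int_supporting_hyperplane_le) auto
  have cF: "compact F" "convex F" "m \<in> F"
    using C m(1) by (auto simp: F_def closed_hyperplane convex_hyperplane
        intro!: compact_Int_closed convex_Int)
  obtain u where u: "u \<in> F" "\<And>x. x \<in> F \<Longrightarrow> (0, 1) \<bullet> x \<le> ((0, 1) :: real \<times> real) \<bullet> u"
    using attains[OF cF(1), of "(0, 1)"] cF(3) by blast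
  define G where "G = F \<inter> {x. (0, 1) \<bullet> x = ((0, 1) :: real \<times> real) \<bullet> u}"
  have G: "G face_of F"
    unfolding G_def using cF(2) u(2) by (intro face_of_Int_supporting_hyperplane_le) auto
  have cG: "compact G" "convex G" "u \<in> G"
    using cF u(1) by (auto simp: G_def closed_hyperplane convex_hyperplane
        intro!: compact_Int_closed convex_Int)
  obtain h where h: "h extreme_point_of G"
    using extreme_point_exists_convex[of G] cG by blast
  have hG: "h \<in> G"
    using h by (simp add: extreme_point_of_def)
  have hC: "h extreme_point_of C"
    using h extreme_point_of_face[OF face_of_trans[OF G F]] by blast
  have max: "a * fst x + b * snd x \<le> a * fst h + b * snd h" if "x \<in> C" for x
  proof -
    have "(a, b) \<bullet> h = (a, b) \<bullet> m"
      using hG by (simp add: G_def F_def)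
    with m(2)[OF that] show ?thesis
      by (simp add: inner_prod_def)
  qed
  have "snd x \<le> snd h" if x: "x \<in> C" "fst x = fst h" for x
  proof (cases "b = 0")
    case True
    with x hG have "x \<in> F"
      by (simp add: G_def F_def inner_prod_def)
    with u(2)[of x] hG show ?thesis
      by (simp add: G_def inner_prod_def)
  next
    case False
    with max[OF x(1)] x(2) b show ?thesis by simp
  qed
  with hC have "h \<in> hull_vertices A"
    by (simp add: hull_vertices_def C_def)
  moreover have "a * fst p + b * snd p \<le> a * fst q + b * snd q"
    using q a b by (intro add_mono mult_left_mono mult_left_mono_neg)
  ultimately show ?thesis
    using max[OF qC] by (meson order_trans)
qed

lemma hull_vertices_subset_efficient: "hull_vertices A \<subseteq> efficient_points A"
  unfolding hull_vertices_def using extreme_point_of_convex_hull by auto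

lemma concave_frontier_ascending:
  assumes "finite A"
  shows "sorted_wrt (\<lambda>p q. fst p < fst q \<and> snd p < snd q) (concave_frontier A)"
proof (rule sorted_wrt_mono_rel)
  show "sorted_wrt (\<lambda>p q. fst p < fst q) (concave_frontier A)"
    using concave_frontier_spec[OF assms] by blast
  fix p q assume "p \<in> set (concave_frontier A)" "q \<in> set (concave_frontier A)" "fst p < fst q"
  moreover from this have "p \<in> efficient_points A" "q \<in> efficient_points A"
    using concave_frontier_spec[OF assms] hull_vertices_subset_efficient by blast+
  ultimately show "fst p < fst q \<and> snd p < snd q"
    unfolding efficient_points_def by force
qed

text \<open>
  This is what makes the residual bound \<open>-\<infinity>\<close> sound: if the first vertices exceed the
  capacity, every completion does.
\<close>

lemma concave_frontier_hd_le:
  assumes fin: "finite A" and p: "p \<in> A"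
  shows "fst (hd (concave_frontier A)) \<le> fst p"
proof -
  obtain h where h: "h \<in> hull_vertices A" "fst h \<le> fst p"
    using hull_vertex_maximizing[OF assms, of "-1" 0] by auto
  with concave_frontier_spec[OF fin] have "h \<in> set (concave_frontier A)"
    "sorted_wrt (\<lambda>p q. fst p < fst q) (concave_frontier A)" by auto
  then have "fst (hd (concave_frontier A)) \<le> fst h"
    by (cases "concave_frontier A") auto
  with h show ?thesis by simp
qed


section \<open>The greedy LP bound\<close>

lemma hull_segments_Cons_Cons:
  "hull_segments (p # q # h) = (q - p) # hull_segments (q # h)"
  by (simp add: hull_segments_def)

lemma hull_segments_pos:
  assumes "sorted_wrt (\<lambda>p q. fst p < fst q \<and> snd p < snd q) h" "(dc, dv) \<in> set (hull_segments h)"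
  shows "0 < dc \<and> 0 < dv"
  using assms
proof (induction h rule: induct_list012)
  case (3 p q h)
  then show ?case
    by (auto simp: hull_segments_Cons_Cons minus_prod_def)
qed (auto simp: hull_segments_def)

text \<open>
  The Lagrangian value of a vertex telescopes along the segments that lead to it; the segments that
  do not are nonnegative extra terms.
\<close>

lemma vertex_le_segments:
  fixes l :: real
  assumes "p \<in> set h"
  shows "snd p - l * fst p \<le> snd (hd h) - l * fst (hd h)
           + (\<Sum>(dc, dv)\<leftarrow>hull_segments h. max 0 (dv - l * dc))"
  using assms
proof (induction h rule: induct_list012)
  case (3 a b h)
  let ?S = "\<lambda>h. \<Sum>(dc, dv)\<leftarrow>hull_segments h. max 0 (dv - l * dc)"
  have nonneg: "0 \<le> ?S h" for h
    by (rule sum_list_nonneg) auto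
  have S: "?S (a # b # h) = max 0 (snd b - snd a - l * (fst b - fst a)) + ?S (b # h)"
    by (simp add: hull_segments_Cons_Cons minus_prod_def case_prod_beta)
  show ?case
  proof (cases "p = a")
    case True
    with nonneg[of "a # b # h"] show ?thesis by simp
  next
    case False
    with 3 have "snd p - l * fst p \<le> snd b - l * fst b + ?S (b # h)" by simp
    also have "snd b - l * fst b \<le> snd a - l * fst a + max 0 (snd b - snd a - l * (fst b - fst a))"
      by (simp add: max_def algebra_simps)
    finally show ?thesis unfolding S by simp
  qed
qed (auto simp: hull_segments_def)

text \<open>
  The greedy value dominates the dual objective for a suitable multiplier. The multiplier is kept
  among the slopes of the list, or zero, so that the segments filled before the critical one have
  nonnegative reduced value.
\<close>

lemma greedy_fill_dual_aux:
  assumes "0 \<le> K" "\<forall>(dc, dv)\<in>set S. 0 < dc \<and> 0 < dv" "sorted (map (\<lambda>(dc, dv). - (dv / dc)) S)"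
  shows "\<exists>l. (l = 0 \<or> l \<in> (\<lambda>(dc, dv). dv / dc) ` set S) \<and>
           l * K + (\<Sum>(dc, dv)\<leftarrow>S. max 0 (dv - l * dc)) \<le> greedy_fill K S"
  using assms
proof (induction K S rule: greedy_fill.induct)
  case (1 K)
  show ?case by auto
next
  case (2 K dc dv S)
  then have pos: "0 < dc" "0 < dv" by auto
  have steepest: "dv' / dc' \<le> dv / dc" if "(dc', dv') \<in> set S" for dc' dv'
    using "2.prems"(3) that by (auto dest!: bspec[OF _ that])
  show ?case
  proof (cases "dc \<le> K")
    case True
    have "0 \<le> K - dc" "\<forall>(dc, dv)\<in>set S. 0 < dc \<and> 0 < dv"
      "sorted (map (\<lambda>(dc, dv). - (dv / dc)) S)"
      using True "2.prems" by auto
    from "2.IH"[OF True this] obtain l where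
      l: "l = 0 \<or> l \<in> (\<lambda>(dc, dv). dv / dc) ` set S"
      "l * (K - dc) + (\<Sum>(dc, dv)\<leftarrow>S. max 0 (dv - l * dc)) \<le> greedy_fill (K - dc) S"
      by blast
    from l(1) have "l \<le> dv / dc"
    proof
      assume "l \<in> (\<lambda>(dc, dv). dv / dc) ` set S"
      with steepest show ?thesis by auto
    qed (use pos in simp)
    then have "l * dc \<le> dv"
      using pos by (simp add: field_simps)
    with l True show ?thesis
      by (intro exI[of _ l]) (auto simp: algebra_simps)
  next
    case False
    let ?l = "dv / dc"
    have "max 0 (dv' - ?l * dc') = 0" if "(dc', dv') \<in> set S" for dc' dv'
    proof -
      have "0 < dc'" using that "2.prems"(2) by auto
      with steepest[OF that] have "dv' \<le> ?l * dc'" by (simp add: pos_divide_le_eq)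
      then show ?thesis by simp
    qed
    then have "map (\<lambda>(dc, dv). max 0 (dv - ?l * dc)) S = map (\<lambda>_. 0) S"
      by (intro map_cong) auto
    then have "(\<Sum>(dc, dv)\<leftarrow>S. max 0 (dv - ?l * dc)) = 0"
      by (simp only: sum_list_0)
    with False pos show ?thesis
      by (intro exI[of _ ?l]) (auto simp: algebra_simps)
  qed
qed

lemma greedy_fill_dual:
  assumes "0 \<le> K" "\<forall>(dc, dv)\<in>set S. 0 < dc \<and> 0 < dv"
  shows "\<exists>l\<ge>0. l * K + (\<Sum>(dc, dv)\<leftarrow>S. max 0 (dv - l * dc))
           \<le> greedy_fill K (sort_key (\<lambda>(dc, dv). - (dv / dc)) S)"
proof -
  let ?S = "sort_key (\<lambda>(dc, dv). - (dv / dc)) S"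
  obtain l where l: "l = 0 \<or> l \<in> (\<lambda>(dc, dv). dv / dc) ` set ?S"
    "l * K + (\<Sum>(dc, dv)\<leftarrow>?S. max 0 (dv - l * dc)) \<le> greedy_fill K ?S"
    using greedy_fill_dual_aux[of K ?S] assms by auto
  have "(\<Sum>(dc, dv)\<leftarrow>?S. max 0 (dv - l * dc)) = (\<Sum>(dc, dv)\<leftarrow>S. max 0 (dv - l * dc))"
    by (simp flip: sum_mset_sum_list)
  moreover have "0 \<le> dv / dc" if "(dc, dv) \<in> set S" for dc dv
    using assms(2) that by (auto intro: less_imp_le)
  then have "0 \<le> l"
    using l(1) by auto
  ultimately show ?thesis using l(2) by auto
qed

lemma finite_admissible: "finite (admissible P i)"
  by (rule finite_subset[of _ "{1..menu_size P}"]) (auto simp: admissible_def)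

lemma finite_items: "finite (items P)"
  by (simp add: items_def)

lemma selections_admissible: "f \<in> selections P \<Longrightarrow> i \<in> items P \<Longrightarrow> f i \<in> admissible P i"
  by (auto simp: selections_def)

lemma build_hull_dual:
  assumes "j \<in> admissible P i" "0 \<le> l"
  shows "gain D i j - l * cost D i j
           \<le> snd (hd (build_hull P D i)) - l * fst (hd (build_hull P D i))
             + (\<Sum>(dc, dv)\<leftarrow>hull_segments (build_hull P D i). max 0 (dv - l * dc))"
proof -
  let ?A = "(\<lambda>j. (cost D i j, gain D i j)) ` admissible P i"
  have fin: "finite ?A"
    using finite_admissible by simp
  obtain h where h: "h \<in> hull_vertices ?A" "gain D i j - l * cost D i j \<le> snd h - l * fst h"
    using hull_vertex_maximizing[OF fin, of "(cost D i j, gain D i j)" "- l" 1] assms by auto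
  have "h \<in> set (build_hull P D i)"
    unfolding build_hull_def using concave_frontier_spec[OF fin] h(1) by simp
  from vertex_le_segments[OF this, of l] h(2) show ?thesis by linarith
qed

lemma build_hull_hd_le:
  assumes "j \<in> admissible P i"
  shows "fst (hd (build_hull P D i)) \<le> cost D i j"
proof -
  have "(cost D i j, gain D i j) \<in> (\<lambda>j. (cost D i j, gain D i j)) ` admissible P i"
    using assms by blast
  from concave_frontier_hd_le[OF _ this] show ?thesis
    using finite_admissible by (simp add: build_hull_def)
qed

lemma build_hull_segments_pos:
  assumes "(dc, dv) \<in> set (hull_segments (build_hull P D i))"
  shows "0 < dc \<and> 0 < dv"
  using hull_segments_pos[OF concave_frontier_ascending, OF _ assms[unfolded build_hull_def]]
    finite_admissible by simp

text \<open>
  Weak LP duality: the capacity left to the free items is priced with the multiplier of the greedy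
  filling, and each free item contributes at most its Lagrangian maximum over the hull.
\<close>

lemma residual_bound_upper:
  assumes H: "\<And>i. i \<in> items P \<Longrightarrow> H i = build_hull P D i"
    and f: "f \<in> mckp_feasible P D" and ext: "extends f p"
  shows "ereal (total_gain P D f) \<le> residual_bound P D H p"
proof -
  define fixd where "fixd = items P \<inter> dom p"
  define free where "free = items P - dom p"
  define K where "K = capacity D - (\<Sum>i\<in>fixd. cost D i (the (p i))) - (\<Sum>i\<in>free. fst (hd (H i)))"
  define base where "base = (\<Sum>i\<in>fixd. gain D i (the (p i))) + (\<Sum>i\<in>free. snd (hd (H i)))"
  define segs where "segs = concat (map (\<lambda>i. hull_segments (H i)) (sorted_list_of_set free))"
  have bound: "residual_bound P D H p = (if K < 0 then -\<infinity>
      else ereal (base + greedy_fill K (sort_key (\<lambda>(dc, dv). - (dv / dc)) segs)))"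
    by (simp add: residual_bound_def K_def base_def segs_def fixd_def free_def Let_def)
  have fin: "finite fixd" "finite free" and free_items: "free \<subseteq> items P"
    by (auto simp: fixd_def free_def finite_items)
  have adm: "f i \<in> admissible P i" if "i \<in> items P" for i
    using f that selections_admissible by (auto simp: mckp_feasible_def)
  have split: "(\<Sum>i\<in>items P. w i (f i)) = (\<Sum>i\<in>fixd. w i (the (p i))) + (\<Sum>i\<in>free. w i (f i))"
    for w :: "nat \<Rightarrow> nat \<Rightarrow> real"
  proof -
    have "items P = fixd \<union> free" "fixd \<inter> free = {}"
      by (auto simp: fixd_def free_def)
    then have "(\<Sum>i\<in>items P. w i (f i)) = (\<Sum>i\<in>fixd. w i (f i)) + (\<Sum>i\<in>free. w i (f i))"
      using fin by (simp add: sum.union_disjoint)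
    moreover have "(\<Sum>i\<in>fixd. w i (f i)) = (\<Sum>i\<in>fixd. w i (the (p i)))"
      using ext by (intro sum.cong) (auto simp: extends_def fixd_def)
    ultimately show ?thesis by simp
  qed
  have "(\<Sum>i\<in>items P. cost D i (f i)) \<le> capacity D"
    using f by (simp add: mckp_feasible_def)
  then have room: "(\<Sum>i\<in>free. cost D i (f i)) - (\<Sum>i\<in>free. fst (hd (H i))) \<le> K"
    by (simp add: K_def split)
  have "(\<Sum>i\<in>free. fst (hd (H i))) \<le> (\<Sum>i\<in>free. cost D i (f i))"
    using free_items adm H by (intro sum_mono) (simp add: build_hull_hd_le subset_iff)
  with room have K: "0 \<le> K" by linarith
  have "\<forall>(dc, dv)\<in>set segs. 0 < dc \<and> 0 < dv"
    using build_hull_segments_pos free_items H fin by (fastforce simp: segs_def)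
  from greedy_fill_dual[OF K this] obtain l where l: "0 \<le> l"
    "l * K + (\<Sum>(dc, dv)\<leftarrow>segs. max 0 (dv - l * dc))
       \<le> greedy_fill K (sort_key (\<lambda>(dc, dv). - (dv / dc)) segs)"
    by blast
  let ?g = "\<lambda>i. \<Sum>(dc, dv)\<leftarrow>hull_segments (H i). max 0 (dv - l * dc)"
  have "(\<Sum>(dc, dv)\<leftarrow>concat (map (\<lambda>i. hull_segments (H i)) xs). max 0 (dv - l * dc))
      = sum_list (map ?g xs)" for xs
    by (induction xs) auto
  then have segs_sum: "(\<Sum>(dc, dv)\<leftarrow>segs. max 0 (dv - l * dc)) = (\<Sum>i\<in>free. ?g i)"
    using fin by (simp add: segs_def sum_list_distinct_conv_sum_set)
  have "(\<Sum>i\<in>free. gain D i (f i) - l * cost D i (f i))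
      \<le> (\<Sum>i\<in>free. snd (hd (H i)) - l * fst (hd (H i)) + ?g i)"
  proof (rule sum_mono)
    fix i assume "i \<in> free"
    then have "i \<in> items P" using free_items by blast
    with build_hull_dual[OF adm l(1), of i D] H
    show "gain D i (f i) - l * cost D i (f i) \<le> snd (hd (H i)) - l * fst (hd (H i)) + ?g i"
      by simp
  qed
  then have "(\<Sum>i\<in>free. gain D i (f i))
      \<le> (\<Sum>i\<in>free. snd (hd (H i)))
        + l * ((\<Sum>i\<in>free. cost D i (f i)) - (\<Sum>i\<in>free. fst (hd (H i)))) + (\<Sum>i\<in>free. ?g i)"
    by (simp add: sum.distrib sum_subtractf sum_distrib_left algebra_simps)
  also have "\<dots> \<le> (\<Sum>i\<in>free. snd (hd (H i))) + l * K + (\<Sum>i\<in>free. ?g i)"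
    using room l(1) by (simp add: mult_left_mono)
  finally have "total_gain P D f \<le> base + greedy_fill K (sort_key (\<lambda>(dc, dv). - (dv / dc)) segs)"
    using l(2) by (simp add: total_gain_def base_def split segs_sum)
  with K bound show ?thesis by simp
qed


section \<open>Correctness of branch-and-bound\<close>

text \<open>
  An option that dominates a given one may be dominated in turn and hence removed as well; by
  finiteness one of its dominators is undominated and survives.
\<close>

lemma undominated_option_above:
  assumes "j \<in> admissible P i"
  shows "\<exists>k\<in>admissible P i. \<not> dominated_option P D i k \<and> cost D i k \<le> cost D i j \<and> gain D i j \<le> gain D i k"
proof -
  let ?A = "(\<lambda>j. (cost D i j, gain D i j)) ` admissible P i"
  have "finite ?A" "(cost D i j, gain D i j) \<in> ?A"
    using assms finite_admissible by blast+
  from efficient_point_above[OF this] obtain q where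
    q: "q \<in> efficient_points ?A" "fst q \<le> cost D i j" "gain D i j \<le> snd q"
    by auto
  from q(1) obtain k where k: "k \<in> admissible P i" "q = (cost D i k, gain D i k)"
    by (auto simp: efficient_points_def)
  with q(1) have "\<not> dominated_option P D i k"
    by (simp add: efficient_points_def dominated_option_def)
  with k q(2,3) show ?thesis
    by auto
qed

lemma search_state_incumbent_feasible:
  "search_state P D H N inc \<Longrightarrow> inc = Some f \<Longrightarrow> f \<in> mckp_feasible P D"
  by (induction arbitrary: f rule: search_state.induct) simp_all

text \<open>
  The exchange of a removed option stays inside the node that is being branched on because its
  branching item is still free there.
\<close>

lemma branch_covers:
  assumes f: "f \<in> mckp_feasible P D" "extends f p"
    and i: "i \<in> items P" "p i = None"
    and J: "\<forall>j\<in>admissible P i - J. dominated_option P D i j"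
  shows "\<exists>j\<in>J. \<exists>g\<in>mckp_feasible P D. extends g (p(i \<mapsto> j)) \<and> total_gain P D f \<le> total_gain P D g"
proof -
  have "f \<in> selections P"
    using f by (simp add: mckp_feasible_def)
  then obtain k where k: "k \<in> admissible P i" "\<not> dominated_option P D i k"
    "cost D i k \<le> cost D i (f i)" "gain D i (f i) \<le> gain D i k"
    using undominated_option_above[of "f i" P i D] selections_admissible i by blast
  let ?g = "f(i := k)"
  have "?g \<in> selections P"
    using \<open>f \<in> selections P\<close> k(1) i(1) unfolding selections_def PiE_def extensional_def by auto
  moreover have "(\<Sum>i\<in>items P. cost D i (?g i)) \<le> (\<Sum>i\<in>items P. cost D i (f i))"
    using k(3) by (intro sum_mono) auto
  ultimately have "?g \<in> mckp_feasible P D"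
    using f(1) by (simp add: mckp_feasible_def)
  moreover have "total_gain P D f \<le> total_gain P D ?g"
    unfolding total_gain_def using k(4) by (intro sum_mono) auto
  moreover have "extends ?g (p(i \<mapsto> k))"
    using f(2) by (auto simp: extends_def)
  ultimately show ?thesis
    using k(1,2) J by blast
qed

lemma search_state_covers:
  assumes H: "\<And>i. i \<in> items P \<Longrightarrow> H i = build_hull P D i"
    and "search_state P D H N inc" and "f \<in> mckp_feasible P D"
  shows "ereal (total_gain P D f) \<le> incumbent_value P D inc \<or>
    (\<exists>p\<in>N. \<exists>g\<in>mckp_feasible P D. extends g p \<and> total_gain P D f \<le> total_gain P D g)"
  using assms(2,3)
proof (induction rule: search_state.induct)
  case start
  then show ?case by (auto simp: extends_def)
next
  case (improve N inc p h)
  from improve.IH[OF improve.prems] show ?case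
  proof
    assume "ereal (total_gain P D f) \<le> incumbent_value P D inc"
    also have "\<dots> \<le> incumbent_value P D (Some h)"
      using improve.hyps by (simp add: incumbent_value_def)
    finally show ?thesis ..
  qed blast
next
  case (prune N inc p)
  from prune.IH[OF prune.prems] show ?case
  proof
    assume "\<exists>q\<in>N. \<exists>g\<in>mckp_feasible P D. extends g q \<and> total_gain P D f \<le> total_gain P D g"
    then obtain q g where g: "q \<in> N" "g \<in> mckp_feasible P D" "extends g q"
      "total_gain P D f \<le> total_gain P D g" by blast
    show ?thesis
    proof (cases "q = p")
      case True
      with g prune.hyps have le: "residual_bound P D H p \<le> incumbent_value P D inc" by blast
      have "ereal (total_gain P D f) \<le> ereal (total_gain P D g)"
        using g(4) by simp
      also have "\<dots> \<le> residual_bound P D H p"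
        using residual_bound_upper[OF H g(2)] g(3) True by blast
      finally show ?thesis using le by (meson order_trans)
    qed (use g in blast)
  qed blast
next
  case (branch N inc p i J)
  from branch.IH[OF branch.prems] show ?case
  proof
    assume "\<exists>q\<in>N. \<exists>g\<in>mckp_feasible P D. extends g q \<and> total_gain P D f \<le> total_gain P D g"
    then obtain q g where g: "q \<in> N" "g \<in> mckp_feasible P D" "extends g q"
      "total_gain P D f \<le> total_gain P D g" by blast
    show ?thesis
    proof (cases "q = p")
      case True
      with g branch.hyps obtain j g' where g': "j \<in> J" "g' \<in> mckp_feasible P D"
        "extends g' (p(i \<mapsto> j))" "total_gain P D g \<le> total_gain P D g'"
        using branch_covers[of g P D p i J] by blast
      have "total_gain P D f \<le> total_gain P D g'"
        using g(4) g'(4) by (rule order_trans)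
      with g' show ?thesis by blast
    qed (use g in blast)
  qed blast
qed


section \<open>The sweep against recomputation\<close>

lemma point_mset_eq_imp_build_hull_eq:
  assumes "point_mset P D i = point_mset P D' i"
  shows "build_hull P D i = build_hull P D' i"
proof -
  have "set_mset (point_mset P D i) = set_mset (point_mset P D' i)"
    using assms by simp
  then show ?thesis
    by (simp add: point_mset_def build_hull_def finite_admissible)
qed

lemma guarded_reuse_builds_hull:
  assumes "guarded_hull_reuse P \<Theta> E" "\<theta> \<in> set \<Theta>" "i \<in> items P"
  shows "hull_at E \<theta> i = build_hull P (data_at E \<theta>) i"
proof -
  have "hull_at E (\<Theta> ! k) i = build_hull P (data_at E (\<Theta> ! k)) i" if "k < length \<Theta>" for k
    using that
  proof (induction k)
    case 0
    with assms(1,3) show ?case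
      unfolding guarded_hull_reuse_def by blast
  next
    case (Suc k)
    then have IH: "hull_at E (\<Theta> ! k) i = build_hull P (data_at E (\<Theta> ! k)) i" by simp
    from assms(1,3) Suc.prems consider
      "point_mset P (data_at E (\<Theta> ! Suc k)) i = point_mset P (data_at E (\<Theta> ! k)) i"
      "hull_at E (\<Theta> ! Suc k) i = hull_at E (\<Theta> ! k) i"
      | "hull_at E (\<Theta> ! Suc k) i = build_hull P (data_at E (\<Theta> ! Suc k)) i"
      unfolding guarded_hull_reuse_def by (metis diff_Suc_1)
    then show ?case
    proof cases
      case 1
      with IH show ?thesis
        using point_mset_eq_imp_build_hull_eq[OF 1(1)] by simp
    qed
  qed
  with assms(2) show ?thesis by (metis in_set_conv_nth)
qed

lemma same_fixed_data_mckp: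
  assumes "same_fixed_data P D D'"
  shows "mckp_feasible P D = mckp_feasible P D'"
    and "f \<in> selections P \<Longrightarrow> total_gain P D f = total_gain P D' f"
proof -
  have "(\<Sum>i\<in>items P. cost D i (f i)) = (\<Sum>i\<in>items P. cost D' i (f i))" if "f \<in> selections P" for f
    using assms that by (intro sum.cong) (auto simp: same_fixed_data_def selections_admissible)
  then show "mckp_feasible P D = mckp_feasible P D'"
    using assms by (auto simp: mckp_feasible_def same_fixed_data_def)
  show "total_gain P D f = total_gain P D' f" if "f \<in> selections P"
    using assms that unfolding total_gain_def
    by (intro sum.cong) (auto simp: same_fixed_data_def selections_admissible)
qed

text \<open>
  The property shared by the two procedures from which the validity of their outputs follows. The
  hulls are compared with those of the data held, not of recomputed data, because branch-and-bound
  needs its hulls and its data to match each other.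
\<close>

definition faithful :: "pricing \<Rightarrow> enumeration \<Rightarrow> bool" where
  "faithful P E \<longleftrightarrow> (\<forall>\<theta>\<in>thresholds P. same_fixed_data P (data_at E \<theta>) (recompute P \<theta>) \<and>
     (\<forall>i\<in>items P. hull_at E \<theta> i = build_hull P (data_at E \<theta>) i))"

lemma faithful_independent_enumeration: "faithful P (independent_enumeration P)"
  by (simp add: faithful_def independent_enumeration_def same_fixed_data_def)

lemma faithful_mckp:
  assumes "faithful P E" "\<theta> \<in> thresholds P"
  shows "mckp_feasible P (data_at E \<theta>) = mckp_feasible P (recompute P \<theta>)"
    and "f \<in> mckp_feasible P (recompute P \<theta>) \<Longrightarrow> total_gain P (data_at E \<theta>) f = revenue P f"
proof -
  have same: "same_fixed_data P (data_at E \<theta>) (recompute P \<theta>)"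
    using assms by (simp add: faithful_def)
  show "mckp_feasible P (data_at E \<theta>) = mckp_feasible P (recompute P \<theta>)"
    using same_fixed_data_mckp(1)[OF same] .
  show "total_gain P (data_at E \<theta>) f = revenue P f" if "f \<in> mckp_feasible P (recompute P \<theta>)"
    using same_fixed_data_mckp(2)[OF same, of f] that
    by (simp add: mckp_feasible_def total_gain_def revenue_def recompute_def)
qed

lemma total_gain_recompute: "total_gain P (recompute P \<theta>) f = revenue P f"
  by (simp add: total_gain_def revenue_def recompute_def)

lemma faithful_lp_bound_valid:
  assumes "faithful P E" "\<theta> \<in> thresholds P"
  shows "lp_bound_valid P \<theta> (lp_bound P E \<theta>)"
  unfolding lp_bound_valid_def Z_IP_def
proof (rule SUP_least)
  fix f assume f: "f \<in> mckp_feasible P (recompute P \<theta>)"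
  then have "ereal (total_gain P (data_at E \<theta>) f) \<le> lp_bound P E \<theta>"
    unfolding lp_bound_def using assms faithful_mckp(1)[OF assms]
    by (intro residual_bound_upper) (auto simp: faithful_def extends_def)
  then show "ereal (total_gain P (recompute P \<theta>) f) \<le> lp_bound P E \<theta>"
    using faithful_mckp(2)[OF assms f] by (simp add: total_gain_recompute)
qed

lemma faithful_incumbent_feasible:
  assumes "faithful P E" "\<theta> \<in> thresholds P"
    and "search_state P (data_at E \<theta>) (hull_at E \<theta>) N (Some f)"
  shows "f \<in> mckp_feasible P (recompute P \<theta>)"
  using search_state_incumbent_feasible[OF assms(3) refl] faithful_mckp(1)[OF assms(1,2)] by simp

lemma faithful_completed_search_optimal:
  assumes faith: "faithful P E" "\<theta> \<in> thresholds P"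
    and search: "completed_search P E \<theta> inc" and g: "g \<in> mckp_feasible P (recompute P \<theta>)"
  shows "\<exists>f. inc = Some f \<and> f \<in> mckp_feasible P (recompute P \<theta>) \<and> revenue P g \<le> revenue P f"
proof -
  have s: "search_state P (data_at E \<theta>) (hull_at E \<theta>) {} inc"
    using search by (simp add: completed_search_def)
  have "ereal (total_gain P (data_at E \<theta>) g) \<le> incumbent_value P (data_at E \<theta>) inc"
    using search_state_covers[OF _ s, of g] g faithful_mckp(1)[OF faith] faith
    by (auto simp: faithful_def)
  then obtain f where f: "inc = Some f"
    "total_gain P (data_at E \<theta>) g \<le> total_gain P (data_at E \<theta>) f"
    by (cases inc) (auto simp: incumbent_value_def)
  have "f \<in> mckp_feasible P (recompute P \<theta>)"
    using faithful_incumbent_feasible[OF faith] s f(1) by blast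
  with f g show ?thesis
    using faithful_mckp(2)[OF faith] by auto
qed

lemma faithful_fixed_certificate_valid:
  assumes faith: "faithful P E" "\<theta> \<in> thresholds P" and search: "completed_search P E \<theta> inc"
  shows "fixed_certificate_valid P \<theta> inc"
proof (cases inc)
  case None
  with faithful_completed_search_optimal[OF assms] show ?thesis
    by (auto simp: fixed_certificate_valid_def)
next
  case (Some f)
  have f: "f \<in> mckp_feasible P (recompute P \<theta>)"
    using faithful_incumbent_feasible[OF faith] search Some by (auto simp: completed_search_def)
  have "Z_IP P \<theta> = ereal (revenue P f)"
    unfolding Z_IP_def total_gain_recompute
  proof (rule antisym)
    show "(SUP g\<in>mckp_feasible P (recompute P \<theta>). ereal (revenue P g)) \<le> ereal (revenue P f)"
      using faithful_completed_search_optimal[OF assms] Some by (intro SUP_least) auto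
  qed (use f in \<open>auto intro: SUP_upper\<close>)
  with f Some show ?thesis
    by (simp add: fixed_certificate_valid_def total_gain_recompute)
qed


section \<open>The robust constraint as a union over thresholds\<close>

lemma sum_take_le_threshold:
  fixes xs :: "real list"
  assumes "0 \<le> \<theta>"
  shows "sum_list (take k xs) \<le> real k * \<theta> + (\<Sum>x\<leftarrow>xs. max 0 (x - \<theta>))"
proof (induction xs arbitrary: k)
  case Nil
  with assms show ?case by simp
next
  case (Cons x xs)
  show ?case
  proof (cases k)
    case 0
    have "0 \<le> (\<Sum>x\<leftarrow>x # xs. max 0 (x - \<theta>))"
      by (rule sum_list_nonneg) auto
    with 0 show ?thesis by simp
  next
    case (Suc k')
    with Cons.IH[of k'] show ?thesis by (simp add: algebra_simps max_def)
  qed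
qed

text \<open>
  Equality holds at a threshold that separates the first \<open>k\<close> entries of the descending list
  from the others. The entry right after them serves; if there is none, zero does.
\<close>

lemma sum_take_eq_threshold:
  fixes xs :: "real list"
  assumes "sorted_wrt (\<ge>) xs" "\<forall>x\<in>set xs. 0 \<le> x" "k \<le> length xs"
  shows "\<exists>\<theta>\<in>insert 0 (set xs). sum_list (take k xs) = real k * \<theta> + (\<Sum>x\<leftarrow>xs. max 0 (x - \<theta>))"
proof -
  define \<theta> where "\<theta> = (if k < length xs then xs ! k else 0)"
  have large: "\<theta> \<le> x" if "x \<in> set (take k xs)" for x
  proof -
    from that obtain m where m: "x = xs ! m" "m < k" "m < length xs"
      by (auto simp: in_set_conv_nth)
    show ?thesis
    proof (cases "k < length xs")
      case True
      with m assms(1) show ?thesis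
        by (simp add: \<theta>_def sorted_wrt_iff_nth_less)
    next
      case False
      with m assms(2) show ?thesis
        by (simp add: \<theta>_def)
    qed
  qed
  have small: "x \<le> \<theta>" if "x \<in> set (drop k xs)" for x
  proof -
    from that obtain m where m: "x = xs ! (k + m)" "k + m < length xs"
      by (auto simp: in_set_conv_nth)
    then have \<theta>: "\<theta> = xs ! k" by (simp add: \<theta>_def)
    show ?thesis
    proof (cases "m = 0")
      case False
      with m assms(1) show ?thesis
        unfolding \<theta> by (simp add: sorted_wrt_iff_nth_less)
    qed (simp add: m \<theta>)
  qed
  have "(\<Sum>x\<leftarrow>take k xs. max 0 (x - \<theta>)) = (\<Sum>x\<leftarrow>take k xs. x - \<theta>)"
    using large by (intro arg_cong[of _ _ sum_list] map_cong) auto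
  also have "\<dots> = sum_list (take k xs) - real k * \<theta>"
    using assms(3) by (simp add: sum_list_subtractf sum_list_triv)
  finally have *: "(\<Sum>x\<leftarrow>take k xs. max 0 (x - \<theta>)) = sum_list (take k xs) - real k * \<theta>" .
  have "map (\<lambda>x. max 0 (x - \<theta>)) (drop k xs) = map (\<lambda>_. 0) (drop k xs)"
    using small by (intro map_cong) auto
  then have **: "(\<Sum>x\<leftarrow>drop k xs. max 0 (x - \<theta>)) = 0"
    by (simp only: sum_list_0)
  have "(\<Sum>x\<leftarrow>xs. max 0 (x - \<theta>))
      = (\<Sum>x\<leftarrow>take k xs. max 0 (x - \<theta>)) + (\<Sum>x\<leftarrow>drop k xs. max 0 (x - \<theta>))"
    by (metis append_take_drop_id map_append sum_list_append)
  with * ** have "sum_list (take k xs) = real k * \<theta> + (\<Sum>x\<leftarrow>xs. max 0 (x - \<theta>))" by simp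
  moreover have "\<theta> \<in> insert 0 (set xs)" by (simp add: \<theta>_def)
  ultimately show ?thesis by blast
qed

text \<open>The cost of the most favourable options occurs on both sides of the capacity constraint.\<close>

lemma mckp_feasible_recompute_iff:
  "f \<in> mckp_feasible P (recompute P \<theta>) \<longleftrightarrow>
     f \<in> selections P \<and>
     real (budget P) * \<theta> + (\<Sum>i\<in>items P. max 0 (\<bar>t_coeff P i (f i)\<bar> - \<theta>))
       \<le> (\<Sum>i\<in>items P. s_coeff P i (f i))"
  by (auto simp: mckp_feasible_def recompute_def s_shift_def sum_subtractf)

lemma finite_thresholds: "finite (thresholds P)"
proof -
  have "thresholds P = {0} \<union> (\<Union>i\<in>items P. (\<lambda>j. \<bar>t_coeff P i j\<bar>) ` admissible P i)"
    by (auto simp: thresholds_def)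
  then show ?thesis by (simp add: finite_items finite_admissible)
qed

text \<open>
  The robust constraint subtracts the sum of the largest deviations, which every
  threshold bounds from above, so feasibility at any threshold suffices; the separating threshold
  attains it and is one of the selection's own deviations or zero, hence in the enumerated set.
\<close>

lemma robust_feasible_eq:
  assumes "budget P \<le> num_items P"
  shows "robust_feasible P = (\<Union>\<theta>\<in>thresholds P. mckp_feasible P (recompute P \<theta>))"
proof -
  have "f \<in> robust_feasible P \<longleftrightarrow> (\<exists>\<theta>\<in>thresholds P. f \<in> mckp_feasible P (recompute P \<theta>))"
    if f: "f \<in> selections P" for f
  proof -
    define ts where "ts = map (\<lambda>i. \<bar>t_coeff P i (f i)\<bar>) [1..<Suc (num_items P)]"
    let ?xs = "rev (sort ts)"
    have set_xs: "set ?xs = (\<lambda>i. \<bar>t_coeff P i (f i)\<bar>) ` items P"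
      by (auto simp: ts_def items_def)
    have excess: "(\<Sum>x\<leftarrow>?xs. max 0 (x - \<theta>)) = (\<Sum>i\<in>items P. max 0 (\<bar>t_coeff P i (f i)\<bar> - \<theta>))" for \<theta>
    proof -
      have "(\<Sum>x\<leftarrow>?xs. max 0 (x - \<theta>)) = (\<Sum>x\<leftarrow>ts. max 0 (x - \<theta>))"
        by (simp flip: sum_mset_sum_list)
      also have "\<dots> = (\<Sum>i\<leftarrow>[1..<Suc (num_items P)]. max 0 (\<bar>t_coeff P i (f i)\<bar> - \<theta>))"
        by (simp add: ts_def o_def del: upt_Suc)
      also have "\<dots> = (\<Sum>i\<in>items P. max 0 (\<bar>t_coeff P i (f i)\<bar> - \<theta>))"
        by (simp add: sum_list_distinct_conv_sum_set items_def atLeastLessThanSuc_atLeastAtMost del: upt_Suc)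
      finally show ?thesis .
    qed
    have robust: "f \<in> robust_feasible P \<longleftrightarrow>
        sum_list (take (budget P) ?xs) \<le> (\<Sum>i\<in>items P. s_coeff P i (f i))"
      using f by (simp add: robust_feasible_def ts_def)
    have mckp: "f \<in> mckp_feasible P (recompute P \<theta>) \<longleftrightarrow>
        real (budget P) * \<theta> + (\<Sum>x\<leftarrow>?xs. max 0 (x - \<theta>)) \<le> (\<Sum>i\<in>items P. s_coeff P i (f i))" for \<theta>
      using f by (simp add: mckp_feasible_recompute_iff excess)
    have "insert 0 (set ?xs) \<subseteq> thresholds P"
      unfolding set_xs using selections_admissible[OF f] by (auto simp: thresholds_def)
    moreover have "\<exists>\<theta>\<in>insert 0 (set ?xs).
        sum_list (take (budget P) ?xs) = real (budget P) * \<theta> + (\<Sum>x\<leftarrow>?xs. max 0 (x - \<theta>))"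
    proof (rule sum_take_eq_threshold)
      show "sorted_wrt (\<ge>) ?xs" by (simp add: sorted_wrt_rev)
      show "\<forall>x\<in>set ?xs. 0 \<le> x" unfolding set_xs by auto
      show "budget P \<le> length ?xs" using assms by (simp add: ts_def)
    qed
    ultimately obtain \<theta>0 where sep: "\<theta>0 \<in> thresholds P"
      "sum_list (take (budget P) ?xs) = real (budget P) * \<theta>0 + (\<Sum>x\<leftarrow>?xs. max 0 (x - \<theta>0))"
      by blast
    have weak: "sum_list (take (budget P) ?xs) \<le> real (budget P) * \<theta> + (\<Sum>x\<leftarrow>?xs. max 0 (x - \<theta>))"
      if "\<theta> \<in> thresholds P" for \<theta>
      using that by (intro sum_take_le_threshold) (auto simp: thresholds_def)
    show ?thesis
    proof
      assume "f \<in> robust_feasible P"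
      then have "f \<in> mckp_feasible P (recompute P \<theta>0)"
        unfolding robust mckp sep(2) .
      with sep(1) show "\<exists>\<theta>\<in>thresholds P. f \<in> mckp_feasible P (recompute P \<theta>)" ..
    next
      assume "\<exists>\<theta>\<in>thresholds P. f \<in> mckp_feasible P (recompute P \<theta>)"
      then obtain \<theta> where "\<theta> \<in> thresholds P" "f \<in> mckp_feasible P (recompute P \<theta>)" ..
      then show "f \<in> robust_feasible P"
        unfolding robust mckp using weak[of \<theta>] by linarith
    qed
  qed
  moreover have "f \<in> selections P" if "f \<in> robust_feasible P" for f
    using that by (simp add: robust_feasible_def)
  moreover have "f \<in> selections P" if "f \<in> mckp_feasible P D" for f D
    using that by (simp add: mckp_feasible_def)
  ultimately show ?thesis by blast
qed


section \<open>Validity of the global certificates\<close>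

text \<open>
  A robustly feasible selection competes in the search at the threshold where it is feasible, and the
  incumbent found there is at least as good and itself robustly feasible.
\<close>

lemma faithful_global_certificate_valid:
  assumes budget: "budget P \<le> num_items P" and faith: "faithful P E"
    and search: "completed_global_search P E r"
  shows "global_certificate_valid P r"
proof -
  obtain inc where inc: "\<And>\<theta>. \<theta> \<in> thresholds P \<Longrightarrow> completed_search P E \<theta> (inc \<theta>)"
    and best: "best_robust_incumbent P inc r"
    using search unfolding completed_global_search_def by blast
  define R where "R = {f \<in> robust_feasible P. \<exists>\<theta>\<in>thresholds P. inc \<theta> = Some f}"
  have reach: "\<exists>f\<in>R. revenue P g \<le> revenue P f" if "g \<in> robust_feasible P" for g
  proof -
    from that obtain \<theta> where \<theta>: "\<theta> \<in> thresholds P" "g \<in> mckp_feasible P (recompute P \<theta>)"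
      using robust_feasible_eq[OF budget] by blast
    then obtain f where "inc \<theta> = Some f" "f \<in> mckp_feasible P (recompute P \<theta>)"
      "revenue P g \<le> revenue P f"
      using faithful_completed_search_optimal[OF faith _ inc] by blast
    with \<theta> show ?thesis
      using robust_feasible_eq[OF budget] unfolding R_def by blast
  qed
  have R: "case r of None \<Rightarrow> R = {} | Some f \<Rightarrow> f \<in> R \<and> (\<forall>g\<in>R. revenue P g \<le> revenue P f)"
    using best unfolding best_robust_incumbent_def R_def Let_def .
  show ?thesis
  proof (cases r)
    case None
    with R reach show ?thesis by (auto simp: global_certificate_valid_def)
  next
    case (Some f)
    with R have "f \<in> robust_feasible P" "\<And>g. g \<in> R \<Longrightarrow> revenue P g \<le> revenue P f"
      by (auto simp: R_def)
    with Some reach show ?thesis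
      by (fastforce simp: global_certificate_valid_def)
  qed
qed

lemma limited_certificate_validI:
  assumes budget: "budget P \<le> num_items P" and search: "limited_global_search P E r U"
  shows "limited_certificate_valid P r U"
  unfolding limited_certificate_valid_def
proof
  have "f \<in> robust_feasible P" if "r = Some f" for f
    using search that by (auto simp: limited_global_search_def best_robust_incumbent_def Let_def)
  then show "(case r of None \<Rightarrow> -\<infinity> | Some f \<Rightarrow> ereal (revenue P f)) \<le> robust_optimum P"
    by (auto simp: robust_optimum_def intro: SUP_upper split: option.split)
  show "robust_optimum P \<le> Max (U ` thresholds P)"
    unfolding robust_optimum_def
  proof (rule SUP_least)
    fix f assume "f \<in> robust_feasible P"
    then obtain \<theta> where \<theta>: "\<theta> \<in> thresholds P" "f \<in> mckp_feasible P (recompute P \<theta>)"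
      using robust_feasible_eq[OF budget] by blast
    then have "ereal (revenue P f) \<le> Z_IP P \<theta>"
      unfolding Z_IP_def total_gain_recompute by (intro SUP_upper)
    also have "\<dots> \<le> U \<theta>"
      using search \<theta>(1) by (simp add: limited_global_search_def)
    also have "\<dots> \<le> Max (U ` thresholds P)"
      using \<theta>(1) finite_thresholds by (intro Max_ge) auto
    finally show "ereal (revenue P f) \<le> Max (U ` thresholds P)" .
  qed
qed

theorem proposition13:
  fixes P :: pricing and \<Theta> :: "real list" and E :: enumeration
  assumes "valid_instance P"
    and "sweep_order P \<Theta> E"
    and "set \<Theta> = thresholds P"
    and "\<forall>\<theta>\<in>set \<Theta>. same_fixed_data P (data_at E \<theta>) (recompute P \<theta>)"
    and "guarded_hull_reuse P \<Theta> E"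
  shows
    "(\<forall>\<theta>\<in>thresholds P.
        lp_bound_valid P \<theta> (lp_bound P E \<theta>) \<longleftrightarrow>
        lp_bound_valid P \<theta> (lp_bound P (independent_enumeration P) \<theta>)) \<and>
     (\<forall>\<theta>\<in>thresholds P. \<forall>inc inc'.
        completed_search P E \<theta> inc \<longrightarrow> completed_search P (independent_enumeration P) \<theta> inc' \<longrightarrow>
        (fixed_certificate_valid P \<theta> inc \<longleftrightarrow> fixed_certificate_valid P \<theta> inc')) \<and>
     (\<forall>r r'.
        completed_global_search P E r \<longrightarrow> completed_global_search P (independent_enumeration P) r' \<longrightarrow>
        (global_certificate_valid P r \<longleftrightarrow> global_certificate_valid P r')) \<and>
     (\<forall>r U r' U'.
        limited_global_search P E r U \<longrightarrow> limited_global_search P (independent_enumeration P) r' U' \<longrightarrow>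
        (limited_certificate_valid P r U \<longleftrightarrow> limited_certificate_valid P r' U'))"
proof -
  have budget: "budget P \<le> num_items P"
    using assms(1) by (simp add: valid_instance_def)
  have sweep: "faithful P E"
    using assms(3,4,5) guarded_reuse_builds_hull[of P \<Theta> E] by (simp add: faithful_def)
  note faith = sweep faithful_independent_enumeration
  show ?thesis
    using faith[THEN faithful_lp_bound_valid] faith[THEN faithful_fixed_certificate_valid]
      faith[THEN faithful_global_certificate_valid[OF budget]] limited_certificate_validI[OF budget]
    by blast
qed

end
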